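(* Let $G$ be an evolving group and let $N$ be a normal subgroup of $G$. Then both $N$ and $G/N$ are evolving groups.
   Context: A group $G$ is called evolving if it is finite and if, for every prime number $p$ and for every $p$-subgroup $I$ of $G$, there exists a subgroup $J$ of $G$ that contains $I$ and such that $|G:J|$ is a power of $p$ and $|J:I|$ is coprime to $p$. *)

theory Defs
  imports "HOL-Algebra.Coset" "HOL-Computational_Algebra.Primes"
begin

definition subgroup_index :: "('a, 'b) monoid_scheme \<Rightarrow> 'a set \<Rightarrow> nat" where
  "subgroup_index G H = card (rcosets\<^bsub>G\<^esub> H)"

(* Only used for finite G, where being a p-group means having p-power order;
   k = 0 is allowed, so the trivial subgroup is a p-subgroup for every p. *)
definition p_subgroup :: "nat \<Rightarrow> 'a set \<Rightarrow> ('a, 'b) monoid_scheme \<Rightarrow> bool" where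
  "p_subgroup p I G \<longleftrightarrow> subgroup I G \<and> (\<exists>k::nat. card I = p ^ k)"

definition evolving :: "('a, 'b) monoid_scheme \<Rightarrow> bool" where
  "evolving G \<longleftrightarrow>
     group G \<and> finite (carrier G) \<and>
     (\<forall>(p::nat) I. prime p \<and> p_subgroup p I G \<longrightarrow>
        (\<exists>J. subgroup J G \<and> I \<subseteq> J \<and>
             (\<exists>k::nat. subgroup_index G J = p ^ k) \<and>
             coprime (subgroup_index (G\<lparr>carrier := J\<rparr>) I) p))"

end

theory Submission
  imports Defs "HOL-Algebra.Sylow"
begin

text \<open>
  Along a homomorphism h every index factors as
  |J : P| = |h(J) : h(P)| |J \<inter> ker h : P \<inter> ker h|.
  Take h to be the projection G \<rightarrow> G/N. For a p-subgroup I of N, a subgroup J of G witnessing that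
  G is evolving yields the witness J \<inter> N. For a p-subgroup I of G/N, a Sylow p-subgroup P
  of the preimage of I maps onto I, and a witness J for P yields the witness JN/N.
\<close>

text \<open>Lagrange inside \<open>J\<close>: it lets relative indices be computed from
  cardinalities.\<close>

lemma (in group) subgroup_index_mult_card:
  assumes "finite (carrier G)" "subgroup J G" "subgroup P G" "P \<subseteq> J"
  shows "subgroup_index (G\<lparr>carrier := J\<rparr>) P * card P = card J"
proof -
  interpret J: group "G\<lparr>carrier := J\<rparr>"
    using assms(2) by (rule subgroup_imp_group)
  have "subgroup P (G\<lparr>carrier := J\<rparr>)"
    using assms subgroup_incl by blast
  then show ?thesis
    using J.lagrange[of P] by (simp add: subgroup_index_def order_def)
qed

lemma (in group_hom) subgroup_kernel_Int:
  assumes "subgroup J G"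
  shows "subgroup (J \<inter> kernel G H h) G"
  using assms subgroup_kernel G.subgroups_Inter_pair by blast

text \<open>First isomorphism theorem for the restriction of \<open>h\<close> to \<open>J\<close>,
  whose kernel is \<open>J \<inter> kernel G H h\<close>, followed by Lagrange.\<close>

lemma (in group_hom) card_image_mult_card_kernel:
  assumes "finite (carrier G)" "subgroup J G"
  shows "card (h ` J) * card (J \<inter> kernel G H h) = card J"
proof -
  have JG: "J \<subseteq> carrier G"
    using assms(2) by (rule subgroup.subset)
  interpret J: group "G\<lparr>carrier := J\<rparr>"
    using assms(2) by (rule G.subgroup_imp_group)
  interpret HJ: group "H\<lparr>carrier := h ` J\<rparr>"
    using assms(2) subgroup_img_is_subgroup H.subgroup_imp_group by blast
  \<comment> \<open>The codomain is cut down to the image of \<open>J\<close>, so that the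
    restricted map is surjective, as \<open>FactGroup_iso\<close> demands.\<close>
  interpret hJ: group_hom "G\<lparr>carrier := J\<rparr>" "H\<lparr>carrier := h ` J\<rparr>" h
    by unfold_locales (use JG in \<open>auto simp: hom_def intro!: hom_mult\<close>)
  have ker: "kernel (G\<lparr>carrier := J\<rparr>) (H\<lparr>carrier := h ` J\<rparr>) h = J \<inter> kernel G H h"
    using JG by (auto simp: kernel_def)
  have "G\<lparr>carrier := J\<rparr> Mod (J \<inter> kernel G H h) \<cong> H\<lparr>carrier := h ` J\<rparr>"
    using hJ.FactGroup_iso by (simp add: ker)
  then have "card (rcosets\<^bsub>G\<lparr>carrier := J\<rparr>\<^esub> (J \<inter> kernel G H h)) = card (h ` J)"
    using iso_same_order by (fastforce simp: is_iso_def order_def FactGroup_def)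
  then show ?thesis
    using J.lagrange[OF hJ.subgroup_kernel] by (simp add: ker order_def)
qed

text \<open>Split \<open>card J\<close> and \<open>card P\<close> into image part and kernel part,
  apply Lagrange to each part and cancel \<open>card P\<close>. Later proofs use only that each
  factor divides the index on the left.\<close>

lemma (in group_hom) subgroup_index_image_mult_kernel:
  assumes fin: "finite (carrier G)"
    and J: "subgroup J G" and P: "subgroup P G" and PJ: "P \<subseteq> J"
  shows "subgroup_index (G\<lparr>carrier := J\<rparr>) P =
    subgroup_index (H\<lparr>carrier := h ` J\<rparr>) (h ` P) *
    subgroup_index (G\<lparr>carrier := J \<inter> kernel G H h\<rparr>) (P \<inter> kernel G H h)"
    (is "?i = ?i1 * ?i2")
proof -
  \<comment> \<open>\<open>H\<close> may be infinite here, whereas the Lagrange lemma asks for a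
    finite ambient group; the image of \<open>G\<close> is finite.\<close>
  interpret HC: group_hom G "H\<lparr>carrier := h ` carrier G\<rparr>" h
    using H.subgroup_imp_group[OF subgroup_img_is_subgroup[OF G.subgroup_self]]
    by (auto simp: group_hom_def group_hom_axioms_def hom_def)
  have "?i1 * card (h ` P) = card (h ` J)"
    using HC.H.subgroup_index_mult_card[of "h ` J" "h ` P"] fin PJ
      HC.subgroup_img_is_subgroup[OF J] HC.subgroup_img_is_subgroup[OF P]
    by (simp add: image_mono)
  moreover have "?i2 * card (P \<inter> kernel G H h) = card (J \<inter> kernel G H h)"
    using PJ by (intro G.subgroup_index_mult_card fin subgroup_kernel_Int J P) auto
  ultimately have "card J = (?i1 * ?i2) * card P"
    using card_image_mult_card_kernel[OF fin J] card_image_mult_card_kernel[OF fin P]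
    by (metis mult.assoc mult.left_commute)
  moreover have "card P > 0"
    using fin P subgroup.finite_imp_card_positive by blast
  ultimately show ?thesis
    using G.subgroup_index_mult_card[OF fin J P PJ] by (metis mult_cancel2 not_gr_zero)
qed

lemma (in group) p_subgroup_incl:
  assumes "subgroup K G" "p_subgroup p P (G\<lparr>carrier := K\<rparr>)"
  shows "p_subgroup p P G" "P \<subseteq> K"
proof -
  have P: "subgroup P (G\<lparr>carrier := K\<rparr>)" "\<exists>k. card P = p ^ k"
    using assms(2) by (simp_all add: p_subgroup_def)
  show "p_subgroup p P G"
    using incl_subgroup[OF assms(1) P(1)] P(2) by (simp add: p_subgroup_def)
  show "P \<subseteq> K"
    using subgroup.subset[OF P(1)] by simp
qed

text \<open>Sylow's theorem for the full power of \<open>p\<close> in the group order: the index is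
  then the cofactor \<open>m\<close>, which \<open>p\<close> does not divide.\<close>

lemma (in group) sylow_subgroup_index_coprime:
  assumes "finite (carrier G)" "prime p"
  obtains P where "p_subgroup p P G" "coprime (subgroup_index G P) p"
proof -
  have "order G \<noteq> 0"
    using assms(1) order_gt_0_iff_finite by simp
  then obtain m where m: "order G = p ^ multiplicity p (order G) * m" "\<not> p dvd m"
    using multiplicity_decompose'[of "order G" p] assms(2) by (metis not_prime_unit)
  obtain P where P: "subgroup P G" "card P = p ^ multiplicity p (order G)"
    using sylow_thm[OF assms(2) is_group m(1) assms(1)] by blast
  have "subgroup_index G P * p ^ multiplicity p (order G) = order G"
    using lagrange[OF P(1)] P(2) by (simp add: subgroup_index_def)
  then have "subgroup_index G P = m"
    using m(1) \<open>order G \<noteq> 0\<close> by (metis mult.commute mult_cancel2 mult_is_0)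
  then have "coprime (subgroup_index G P) p"
    using m(2) assms(2) by (metis coprime_commute prime_imp_coprime)
  then show thesis
    using that P unfolding p_subgroup_def by blast
qed

lemma (in normal) group_hom_Mod: "group_hom G (G Mod H) (\<lambda>x. H #> x)"
  using r_coset_hom_Mod factorgroup_is_group
  by (simp add: group_hom_def group_hom_axioms_def)

lemma (in normal) kernel_r_coset: "kernel G (G Mod H) (\<lambda>x. H #> x) = H"
proof -
  have "H #> x = H \<longleftrightarrow> x \<in> H" if "x \<in> carrier G" for x
    using that subset coset_join1[OF _ that] coset_join2[OF that] subgroup_axioms by blast
  then show ?thesis
    using subset by (auto simp: kernel_def)
qed

lemma evolving_normal_subgroup:
  assumes ev: "evolving G" and N: "N \<lhd> G"
  shows "evolving (G\<lparr>carrier := N\<rparr>)"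
proof -
  interpret normal N G by (rule N)
  interpret h: group_hom G "G Mod N" "\<lambda>x. N #>\<^bsub>G\<^esub> x"
    by (rule group_hom_Mod)
  have sub: "subgroup N G"
    by (rule normal_imp_subgroup[OF N])
  have ker: "kernel G (G Mod N) (\<lambda>x. N #>\<^bsub>G\<^esub> x) = N"
    by (rule kernel_r_coset)
  have fin: "finite (carrier G)"
    using ev by (simp add: evolving_def)
  show ?thesis
    unfolding evolving_def
  proof (intro conjI allI impI; (elim conjE)?)
    show "group (G\<lparr>carrier := N\<rparr>)"
      by (rule subgroup_imp_group[OF sub])
    show "finite (carrier (G\<lparr>carrier := N\<rparr>))"
      using fin subset finite_subset by auto
    fix p :: nat and I
    assume p: "prime p" and "p_subgroup p I (G\<lparr>carrier := N\<rparr>)"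
    then have pI: "p_subgroup p I G" and IN: "I \<subseteq> N"
      using p_subgroup_incl[OF sub] by blast+
    then have I: "subgroup I G"
      by (simp add: p_subgroup_def)
    obtain J k where J: "subgroup J G" "I \<subseteq> J" "subgroup_index G J = p ^ k"
        "coprime (subgroup_index (G\<lparr>carrier := J\<rparr>) I) p"
      using ev p pI unfolding evolving_def by blast
    have JN: "subgroup (J \<inter> N) G"
      using h.subgroup_kernel_Int[OF J(1)] by (simp add: ker)
    \<comment> \<open>The kernel factor of |G : J|, since \<open>N\<close> is the kernel of the
      projection.\<close>
    have "subgroup_index (G\<lparr>carrier := N\<rparr>) (J \<inter> N) dvd p ^ k"
      using h.subgroup_index_image_mult_kernel[OF fin subgroup_self J(1)]
        subgroup.subset[OF J(1)] J(3) subset by (simp add: ker Int_absorb1)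
    then have "\<exists>k. subgroup_index (G\<lparr>carrier := N\<rparr>) (J \<inter> N) = p ^ k"
      using p divides_primepow_nat by blast
    \<comment> \<open>The kernel factor of |J : I|; here \<open>I \<inter> N = I\<close>.\<close>
    moreover have "subgroup_index (G\<lparr>carrier := J \<inter> N\<rparr>) I dvd
        subgroup_index (G\<lparr>carrier := J\<rparr>) I"
      using h.subgroup_index_image_mult_kernel[OF fin J(1) I J(2)] IN
      by (simp add: ker Int_absorb2)
    then have "coprime (subgroup_index (G\<lparr>carrier := J \<inter> N\<rparr>) I) p"
      using coprime_divisors[OF _ dvd_refl J(4)] by blast
    moreover have "subgroup (J \<inter> N) (G\<lparr>carrier := N\<rparr>)"
      using subgroup_incl[OF JN sub] by simp
    \<comment> \<open>The double carrier update collapses to the inner subgroup, so the last index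
      agrees with the one taken in \<open>G\<close>.\<close>
    ultimately show "\<exists>J. subgroup J (G\<lparr>carrier := N\<rparr>) \<and> I \<subseteq> J \<and>
        (\<exists>k. subgroup_index (G\<lparr>carrier := N\<rparr>) J = p ^ k) \<and>
        coprime (subgroup_index (G\<lparr>carrier := N, carrier := J\<rparr>) I) p"
      using IN J(2) by (intro exI[of _ "J \<inter> N"]) auto
  qed
qed

text \<open>The quotient half of the theorem, for any surjective homomorphism: only surjectivity and
  the image factors of indices enter, not the coset structure.\<close>

lemma evolving_hom_image:
  assumes ev: "evolving G" and "group_hom G H h" and surj: "h ` carrier G = carrier H"
  shows "evolving H"
proof -
  interpret group_hom G H h by fact
  have fin: "finite (carrier G)"
    using ev by (simp add: evolving_def)
  have finH: "finite (carrier H)"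
    using fin surj by (metis finite_imageI)
  show ?thesis
    unfolding evolving_def
  proof (intro conjI allI impI; (elim conjE)?)
    show "group H" "finite (carrier H)"
      by (fact H.is_group finH)+
    fix p :: nat and I
    assume p: "prime p" and "p_subgroup p I H"
    then obtain n where I: "subgroup I H" "card I = p ^ n"
      by (auto simp: p_subgroup_def)
    define K where "K = {x \<in> carrier G. h x \<in> I}"
    have K: "subgroup K G"
    proof (rule G.subgroupI)
      show "K \<noteq> {}"
        using subgroup.one_closed[OF I(1)] by (auto simp: K_def intro!: exI[of _ "\<one>\<^bsub>G\<^esub>"])
    qed (auto simp: K_def subgroup.m_inv_closed[OF I(1)] subgroup.m_closed[OF I(1)])
    have hK: "h ` K = I"
      unfolding K_def
    proof (intro subset_antisym subsetI)
      fix y assume "y \<in> I"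
      moreover from this obtain x where "x \<in> carrier G" "y = h x"
        using subgroup.subset[OF I(1)] surj by blast
      ultimately show "y \<in> h ` {x \<in> carrier G. h x \<in> I}"
        by blast
    qed blast
    interpret K: group "G\<lparr>carrier := K\<rparr>"
      by (rule G.subgroup_imp_group[OF K])
    \<comment> \<open>The preimage \<open>K\<close> need not be a \<open>p\<close>-group, because
      the kernel is arbitrary; a Sylow \<open>p\<close>-subgroup of it is one to which the
      hypothesis on \<open>G\<close> applies.\<close>
    obtain P where P': "p_subgroup p P (G\<lparr>carrier := K\<rparr>)"
      and coP: "coprime (subgroup_index (G\<lparr>carrier := K\<rparr>) P) p"
      using K.sylow_subgroup_index_coprime[OF _ p] finite_subset[OF subgroup.subset[OF K] fin]
      by auto
    note pP = G.p_subgroup_incl(1)[OF K P'] and PK = G.p_subgroup_incl(2)[OF K P']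
    then have P: "subgroup P G"
      by (simp add: p_subgroup_def)
    have hP: "subgroup (h ` P) H" "h ` P \<subseteq> I"
      using subgroup_img_is_subgroup[OF P] PK hK by auto
    have idx: "subgroup_index (H\<lparr>carrier := I\<rparr>) (h ` P) * card (h ` P) = p ^ n"
      using H.subgroup_index_mult_card[OF finH I(1) hP] I(2) by simp
    have "subgroup_index (H\<lparr>carrier := I\<rparr>) (h ` P) dvd subgroup_index (G\<lparr>carrier := K\<rparr>) P"
      using subgroup_index_image_mult_kernel[OF fin K P PK] hK by simp
    then have "coprime (subgroup_index (H\<lparr>carrier := I\<rparr>) (h ` P)) (p ^ n)"
      using coprime_divisors[OF _ dvd_refl coP] by simp
    then have "subgroup_index (H\<lparr>carrier := I\<rparr>) (h ` P) = 1"
      using coprime_absorb_left[OF dvdI[OF idx[symmetric]]] by simp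
    then have hPI: "h ` P = I"
      using idx I(2) card_subset_eq[OF finite_subset[OF subgroup.subset[OF I(1)] finH] hP(2)]
      by simp
    obtain J k where J: "subgroup J G" "P \<subseteq> J" "subgroup_index G J = p ^ k"
        "coprime (subgroup_index (G\<lparr>carrier := J\<rparr>) P) p"
      using ev p pP unfolding evolving_def by blast
    \<comment> \<open>The witness is \<open>h\<close>
      J\<open>. This is the image factor of |G : J|, with\<close>h \<open>carrier G\<close> replaced
      by \<open>carrier H\<close> through surjectivity.\<close>
    have "subgroup_index H (h ` J) dvd p ^ k"
      using subgroup_index_image_mult_kernel[OF fin G.subgroup_self J(1)]
        subgroup.subset[OF J(1)] J(3) by (simp add: surj)
    then have "\<exists>k. subgroup_index H (h ` J) = p ^ k"
      using p divides_primepow_nat by blast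
    moreover have "subgroup_index (H\<lparr>carrier := h ` J\<rparr>) I dvd
        subgroup_index (G\<lparr>carrier := J\<rparr>) P"
      using subgroup_index_image_mult_kernel[OF fin J(1) P J(2)] hPI by simp
    then have "coprime (subgroup_index (H\<lparr>carrier := h ` J\<rparr>) I) p"
      using coprime_divisors[OF _ dvd_refl J(4)] by blast
    ultimately show "\<exists>J. subgroup J H \<and> I \<subseteq> J \<and> (\<exists>k. subgroup_index H J = p ^ k) \<and>
        coprime (subgroup_index (H\<lparr>carrier := J\<rparr>) I) p"
      using subgroup_img_is_subgroup[OF J(1)] hPI J(2) by blast
  qed
qed

theorem lemma2:
  fixes G :: "('a, 'b) monoid_scheme" and N :: "'a set"
  assumes "evolving G" and "N \<lhd> G"
  shows "evolving (G\<lparr>carrier := N\<rparr>) \<and> evolving (G Mod N)"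
proof
  interpret normal N G by (rule assms(2))
  show "evolving (G\<lparr>carrier := N\<rparr>)"
    using assms by (rule evolving_normal_subgroup)
  show "evolving (G Mod N)"
    \<comment> \<open>The projection is surjective because the carrier of \<open>G Mod N\<close> is
      by \<open>carrier_FactGroup\<close> the image of \<open>carrier G\<close> under it.\<close>
    using evolving_hom_image[OF assms(1) group_hom_Mod] by (simp add: carrier_FactGroup)
qed

end
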